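(* Let $t\in\mathbb{N}$ be arbitrary. Then the finite monoid $M_2(K^{-\infty}_t)$ of $2\times 2$ matrices over the finite max-plus semiring $K^{-\infty}_t=\{-\infty,0,1,\ldots,t\}$ is generated by the $(t^2+3t+8)/2$ matrices $$X_i=\begin{pmatrix} i & 0\\ 0 & -\infty\end{pmatrix},\qquad Y=\begin{pmatrix} 1 & -\infty\\ -\infty & 0\end{pmatrix},\qquad Z=\begin{pmatrix} -\infty & -\infty\\ -\infty & 0\end{pmatrix},\qquad W_{jk}=\begin{pmatrix} 0 & j\\ k & 0\end{pmatrix},$$ where $i\in\{-\infty,0,\ldots,t\}$ and $j,k\in\{1,\ldots,t\}$ with $j\leq k$.
   Context: $\mathbb{N}=\{0,1,2,\ldots\}$. The max-plus semiring $K^{-\infty}$ is $\mathbb{N}\cup\{-\infty\}$ with $\oplus=\max$ and $\otimes=+$ (with $x\otimes(-\infty)=(-\infty)\otimes x=-\infty$ for all $x$). For $t\in\mathbb{N}$, $K^{-\infty}_t$ is the quotient of $K^{-\infty}$ by the least semiring congruence identifying $t$ and $t+1$. Explicitly, $K^{-\infty}_t=\{-\infty,0,1,\ldots,t\}$ with $a\oplus b=\max\{a,b\}$ (where $-\infty$ is the smallest element) and $a\otimes b=\min\{a+b,t\}$, where $a+b=-\infty$ if $a=-\infty$ or $b=-\infty$. Its multiplicative identity is the number $0$ and its additive identity is $-\infty$. $M_2(K^{-\infty}_t)$ is the monoid of all $2\times 2$ matrices with entries in $K^{-\infty}_t$ under matrix multiplication with respect to $\oplus$ and $\otimes$, i.e.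 $(AB)_{pq}=(A_{p1}\otimes B_{1q})\oplus(A_{p2}\otimes B_{2q})$; its identity is $\begin{pmatrix} 0&-\infty\\ -\infty&0\end{pmatrix}$. The entries $0,1,i,j,k$ in the matrices of the claim denote (the images in $K^{-\infty}_t$ of) the corresponding natural numbers or $-\infty$, not the zero and one of the semiring; in particular the entry $1$ of $Y$ is the image of the natural number $1$, that is $\min\{1,t\}$, which equals $0$ when $t=0$. When $t=0$ the set $\{1,\ldots,t\}$ is empty, so there are no matrices $W_{jk}$. *)

theory Defs
  imports "HOL.Hull" "HOL-Algebra.Ring" "HOL-Library.Extended"
begin

section \<open>Max-plus semirings\<close>

text \<open>
  Elements are taken from \<^typ>\<open>nat extended\<close>, whose maximum and addition are the max-plus
  operations. The extra value \<open>\<infinity>\<close> of this type is excluded by the carriers.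
  Beware that the multiplicative identity is \<^term>\<open>Fin 0\<close> and the additive one is \<open>-\<infinity>\<close>.
\<close>

definition maxplus :: "nat extended ring" where
  "maxplus = \<lparr>carrier = insert (-\<infinity>) (range Fin), mult = (+), one = Fin 0,
              zero = -\<infinity>, add = max\<rparr>"

definition maxplus_trunc :: "nat \<Rightarrow> nat extended ring" where
  "maxplus_trunc t = \<lparr>carrier = insert (-\<infinity>) (Fin ` {..t}),
                      mult = (\<lambda>a b. min (a + b) (Fin t)), one = Fin 0,
                      zero = -\<infinity>, add = max\<rparr>"

definition to_trunc :: "nat \<Rightarrow> nat extended \<Rightarrow> nat extended" where
  "to_trunc t a = min a (Fin t)"

lemma maxplus_simps [simp]:
  "carrier maxplus = insert (-\<infinity>) (range Fin)" "a \<otimes>\<^bsub>maxplus\<^esub> b = a + b"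
  "\<one>\<^bsub>maxplus\<^esub> = Fin 0" "\<zero>\<^bsub>maxplus\<^esub> = -\<infinity>" "a \<oplus>\<^bsub>maxplus\<^esub> b = max a b"
  by (simp_all add: maxplus_def)

lemma maxplus_trunc_simps [simp]:
  "carrier (maxplus_trunc t) = insert (-\<infinity>) (Fin ` {..t})"
  "a \<otimes>\<^bsub>maxplus_trunc t\<^esub> b = min (a + b) (Fin t)"
  "\<one>\<^bsub>maxplus_trunc t\<^esub> = Fin 0" "\<zero>\<^bsub>maxplus_trunc t\<^esub> = -\<infinity>"
  "a \<oplus>\<^bsub>maxplus_trunc t\<^esub> b = max a b"
  by (simp_all add: maxplus_trunc_def)

lemma semiring_maxplus: "semiring maxplus"
  by (intro semiring.intro abelian_monoidI monoidI semiring_axioms.intro) (auto simp: ac_simps)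

lemma semiring_maxplus_trunc: "semiring (maxplus_trunc t)"
  by (intro semiring.intro abelian_monoidI monoidI semiring_axioms.intro) auto

definition semiring_congruence :: "('a, 'b) ring_scheme \<Rightarrow> ('a \<times> 'a) set \<Rightarrow> bool" where
  "semiring_congruence R r \<longleftrightarrow> equiv (carrier R) r \<and>
     (\<forall>(a, a') \<in> r. \<forall>(b, b') \<in> r.
        (a \<oplus>\<^bsub>R\<^esub> b, a' \<oplus>\<^bsub>R\<^esub> b') \<in> r \<and> (a \<otimes>\<^bsub>R\<^esub> b, a' \<otimes>\<^bsub>R\<^esub> b') \<in> r)"

text \<open>
  The next two facts say that \<^const>\<open>maxplus_trunc\<close> is the quotient of \<^const>\<open>maxplus\<close> by the
  least congruence identifying \<open>t\<close> and \<open>t + 1\<close>, with projection \<^const>\<open>to_trunc\<close>.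
\<close>

lemma to_trunc_surj_hom:
  "to_trunc t \<in> ring_hom maxplus (maxplus_trunc t)"
  "to_trunc t ` carrier maxplus = carrier (maxplus_trunc t)"
proof -
  show "to_trunc t \<in> ring_hom maxplus (maxplus_trunc t)"
    by (rule ring_hom_memI) (auto simp: to_trunc_def max_def min_def)
  have "Fin n \<in> to_trunc t ` range Fin" if "n \<le> t" for n
    using that by (intro image_eqI[of _ _ "Fin n"]) (auto simp: to_trunc_def min_def)
  then show "to_trunc t ` carrier maxplus = carrier (maxplus_trunc t)"
    by (auto simp: to_trunc_def)
qed

lemma to_trunc_kernel:
  "{(a, b) \<in> carrier maxplus \<times> carrier maxplus. to_trunc t a = to_trunc t b} =
     \<Inter>{r. semiring_congruence maxplus r \<and> (Fin t, Fin (t + 1)) \<in> r}" (is "?k = ?I")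
proof
  show "?I \<subseteq> ?k"
  proof (rule Inter_lower, intro CollectI conjI)
    show "semiring_congruence maxplus ?k"
    proof -
      define k where "k = ?k"
      have k: "(a, b) \<in> k \<longleftrightarrow>
          a \<in> carrier maxplus \<and> b \<in> carrier maxplus \<and> to_trunc t a = to_trunc t b" for a b
        by (auto simp: k_def)
      have "equiv (carrier maxplus) k"
        unfolding k_def by (rule equivI) (auto simp: refl_on_def sym_def trans_def)
      moreover have "(a \<oplus>\<^bsub>maxplus\<^esub> b, a' \<oplus>\<^bsub>maxplus\<^esub> b') \<in> k"
        "(a \<otimes>\<^bsub>maxplus\<^esub> b, a' \<otimes>\<^bsub>maxplus\<^esub> b') \<in> k"
        if "(a, a') \<in> k" "(b, b') \<in> k" for a a' b b'
      proof -
        have "x \<oplus>\<^bsub>maxplus\<^esub> y \<in> carrier maxplus" "x \<otimes>\<^bsub>maxplus\<^esub> y \<in> carrier maxplus"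
          if "x \<in> carrier maxplus" "y \<in> carrier maxplus" for x y
          using that by auto
        then show "(a \<oplus>\<^bsub>maxplus\<^esub> b, a' \<oplus>\<^bsub>maxplus\<^esub> b') \<in> k"
          "(a \<otimes>\<^bsub>maxplus\<^esub> b, a' \<otimes>\<^bsub>maxplus\<^esub> b') \<in> k"
          using that to_trunc_surj_hom(1)[of t]
          by (simp_all add: k ring_hom_add ring_hom_mult del: maxplus_simps maxplus_trunc_simps)
      qed
      ultimately show ?thesis
        unfolding semiring_congruence_def k_def [symmetric] by auto
    qed
  qed (auto simp: to_trunc_def)
  show "?k \<subseteq> ?I"
  proof (rule Inter_greatest)
    fix r assume "r \<in> {r. semiring_congruence maxplus r \<and> (Fin t, Fin (t + 1)) \<in> r}"
    then have c: "semiring_congruence maxplus r" and tr: "(Fin t, Fin (t + 1)) \<in> r" by auto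
    have e: "equiv (carrier maxplus) r" using c by (simp add: semiring_congruence_def)
    have rf: "(x, x) \<in> r" if "x \<in> carrier maxplus" for x
      using e that by (meson equiv_def refl_onD)
    have sy: "(y, x) \<in> r" if "(x, y) \<in> r" for x y
      using e that by (meson equiv_def symD)
    have tn: "(x, z) \<in> r" if "(x, y) \<in> r" "(y, z) \<in> r" for x y z
      using e that by (meson equiv_def transD)
    have step: "(Fin (t + d), Fin (t + d + 1)) \<in> r" for d
    proof -
      have "(Fin t + Fin d, Fin (t + 1) + Fin d) \<in> r"
        using c tr rf[of "Fin d"] unfolding semiring_congruence_def by fastforce
      then show ?thesis by (simp add: ac_simps)
    qed
    have *: "(Fin t, Fin (t + d)) \<in> r" for d
    proof (induction d)
      case (Suc d)
      then show ?case using tn[OF Suc step[of d]] by simp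
    qed (simp add: rf)
    have ge: "(Fin t, Fin n) \<in> r" if "t \<le> n" for n
      using *[of "n - t"] that by simp
    show "?k \<subseteq> r"
    proof (clarify)
      fix a b assume ab: "a \<in> carrier maxplus" "b \<in> carrier maxplus" "to_trunc t a = to_trunc t b"
      then consider "a = b" | m n where "a = Fin m" "b = Fin n" "t \<le> m" "t \<le> n"
        by (auto simp: to_trunc_def min_def split: if_splits)
      then show "(a, b) \<in> r" using ab rf ge sy tn by cases blast+
    qed
  qed
qed

section \<open>Two-by-two matrices over a semiring\<close>

text \<open>\<^term>\<open>Mat2 a b c d\<close> has first row \<open>a b\<close> and second row \<open>c d\<close>.\<close>

datatype 'a mat2 = Mat2 'a 'a 'a 'a

fun mat2_mult :: "('a, 'b) ring_scheme \<Rightarrow> 'a mat2 \<Rightarrow> 'a mat2 \<Rightarrow> 'a mat2" where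
  "mat2_mult R (Mat2 a b c d) (Mat2 a' b' c' d') =
     Mat2 (a \<otimes>\<^bsub>R\<^esub> a' \<oplus>\<^bsub>R\<^esub> b \<otimes>\<^bsub>R\<^esub> c') (a \<otimes>\<^bsub>R\<^esub> b' \<oplus>\<^bsub>R\<^esub> b \<otimes>\<^bsub>R\<^esub> d')
          (c \<otimes>\<^bsub>R\<^esub> a' \<oplus>\<^bsub>R\<^esub> d \<otimes>\<^bsub>R\<^esub> c') (c \<otimes>\<^bsub>R\<^esub> b' \<oplus>\<^bsub>R\<^esub> d \<otimes>\<^bsub>R\<^esub> d')"

definition mat2_monoid :: "('a, 'b) ring_scheme \<Rightarrow> 'a mat2 monoid" where
  "mat2_monoid R =
     \<lparr>carrier = {A. set_mat2 A \<subseteq> carrier R}, mult = mat2_mult R,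
      one = Mat2 \<one>\<^bsub>R\<^esub> \<zero>\<^bsub>R\<^esub> \<zero>\<^bsub>R\<^esub> \<one>\<^bsub>R\<^esub>\<rparr>"

definition monoid_generated :: "('a, 'b) monoid_scheme \<Rightarrow> 'a set \<Rightarrow> 'a set" where
  "monoid_generated G S = (\<lambda>H. submonoid H G) hull S"

section \<open>The generators\<close>

definition mat_X :: "nat extended \<Rightarrow> nat extended mat2" where
  "mat_X i = Mat2 i (Fin 0) (Fin 0) (-\<infinity>)"

text \<open>The entry \<open>1\<close> is the image of the natural number 1, which is \<^term>\<open>Fin 0\<close> for \<open>t = 0\<close>.\<close>

definition mat_Y :: "nat \<Rightarrow> nat extended mat2" where
  "mat_Y t = Mat2 (to_trunc t (Fin 1)) (-\<infinity>) (-\<infinity>) (Fin 0)"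

definition mat_Z :: "nat extended mat2" where
  "mat_Z = Mat2 (-\<infinity>) (-\<infinity>) (-\<infinity>) (Fin 0)"

definition mat_W :: "nat \<Rightarrow> nat \<Rightarrow> nat extended mat2" where
  "mat_W j k = Mat2 (Fin 0) (Fin j) (Fin k) (Fin 0)"

definition generators :: "nat \<Rightarrow> nat extended mat2 set" where
  "generators t =
     mat_X ` carrier (maxplus_trunc t) \<union> {mat_Y t, mat_Z} \<union>
     {mat_W j k | j k. j \<in> {1..t} \<and> k \<in> {1..t} \<and> j \<le> k}"

end

theory Submission
  imports Defs
begin

text \<open>
  The diagonal matrices are generated by \<open>Y\<close>, \<open>Z\<close> and the swap \<open>X\<^bsub>-\<infinity>\<^esub>\<close>. Multiplying by them
  on the left and right adds constants to the rows and columns of a matrix, and multiplying by the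
  swap exchanges rows or columns. So it suffices to find, for every matrix, a generated one from
  which these operations lead to it.

  A matrix with an entry \<open>-\<infinity>\<close> can be permuted to have that entry at the bottom right, and is then
  a rescaling of the matrix \<open>X\<^bsub>a\<^esub>\<close> whose top left entry is the same
  (\<open>with_minus_infinity_mem\<close>). A matrix with finite entries only can be reduced, by subtracting
  row minima and then column minima, to one with zeros on a diagonal, hence after a swap to
  one with zeros on the main diagonal (\<open>finite_entries_mem\<close>). If both off-diagonal entries are
  positive, this is a \<open>W\<^bsub>jk\<^esub>\<close> up to transposition, and transposing it amounts to conjugation
  by the swap. Otherwise three entries are \<open>0\<close>; with the fourth one permuted to the bottom right,
  the matrix is a product of two triangular matrices, which have an entry \<open>-\<infinity>\<close> and have been
  dealt with (\<open>three_zeros_mem\<close>).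
\<close>

section \<open>The matrix monoid\<close>

lemma mat2_monoid_simps [simp]:
  "mult (mat2_monoid R) = mat2_mult R"
  "one (mat2_monoid R) = Mat2 \<one>\<^bsub>R\<^esub> \<zero>\<^bsub>R\<^esub> \<zero>\<^bsub>R\<^esub> \<one>\<^bsub>R\<^esub>"
  "Mat2 a b c d \<in> carrier (mat2_monoid R) \<longleftrightarrow>
     a \<in> carrier R \<and> b \<in> carrier R \<and> c \<in> carrier R \<and> d \<in> carrier R"
  by (auto simp: mat2_monoid_def)

lemma (in semiring) monoid_mat2_monoid: "monoid (mat2_monoid R)"
proof (rule monoidI)
  fix A B C assume "A \<in> carrier (mat2_monoid R)" "B \<in> carrier (mat2_monoid R)"
    "C \<in> carrier (mat2_monoid R)"
  then show "A \<otimes>\<^bsub>mat2_monoid R\<^esub> B \<otimes>\<^bsub>mat2_monoid R\<^esub> C =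
      A \<otimes>\<^bsub>mat2_monoid R\<^esub> (B \<otimes>\<^bsub>mat2_monoid R\<^esub> C)"
    by (cases A; cases B; cases C) (simp add: l_distr r_distr m_assoc a_ac)
next
  fix A B assume "A \<in> carrier (mat2_monoid R)" "B \<in> carrier (mat2_monoid R)"
  then show "A \<otimes>\<^bsub>mat2_monoid R\<^esub> B \<in> carrier (mat2_monoid R)"
    by (cases A; cases B) simp
next
  fix A assume "A \<in> carrier (mat2_monoid R)"
  then show "\<one>\<^bsub>mat2_monoid R\<^esub> \<otimes>\<^bsub>mat2_monoid R\<^esub> A = A" "A \<otimes>\<^bsub>mat2_monoid R\<^esub> \<one>\<^bsub>mat2_monoid R\<^esub> = A"
    by (cases A; simp)+
qed simp

lemma finite_mat2_monoid:
  assumes "finite (carrier R)"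
  shows "finite (carrier (mat2_monoid R))"
proof (rule finite_subset)
  let ?C = "carrier R"
  show "carrier (mat2_monoid R) \<subseteq> (\<lambda>(a, b, c, d). Mat2 a b c d) ` (?C \<times> ?C \<times> ?C \<times> ?C)"
  proof
    fix A assume "A \<in> carrier (mat2_monoid R)"
    then show "A \<in> (\<lambda>(a, b, c, d). Mat2 a b c d) ` (?C \<times> ?C \<times> ?C \<times> ?C)"
      by (cases A) (auto simp: image_iff)
  qed
qed (use assms in auto)

section \<open>The number of generators\<close>

lemma card_mat_W_generators:
  "2 * card {mat_W j k | j k. j \<in> {1..t} \<and> k \<in> {1..t} \<and> j \<le> k} = t * (t + 1)"
proof -
  have "{mat_W j k | j k. j \<in> {1..t} \<and> k \<in> {1..t} \<and> j \<le> k} =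
      (\<lambda>(k, j). mat_W j k) ` (SIGMA k:{1..t}. {1..k})"
    by (auto simp: image_iff Bex_def) (metis le_trans)
  moreover have "inj_on (\<lambda>(k, j). mat_W j k) (SIGMA k:{1..t}. {1..k})"
    by (auto simp: inj_on_def mat_W_def)
  ultimately have "card {mat_W j k | j k. j \<in> {1..t} \<and> k \<in> {1..t} \<and> j \<le> k} = (\<Sum>k = 1..t. k)"
    by (simp add: card_image)
  also have "2 * \<dots> = t * (t + 1)"
    using double_gauss_sum_from_Suc_0[of t, where 'a = nat] by simp
  finally show ?thesis .
qed

lemma card_generators: "2 * card (generators t) = t^2 + 3 * t + 8"
proof -
  let ?X = "mat_X ` carrier (maxplus_trunc t)" and ?YZ = "{mat_Y t, mat_Z}"
  let ?W = "{mat_W j k | j k. j \<in> {1..t} \<and> k \<in> {1..t} \<and> j \<le> k}"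
  have "card ?X = t + 2"
  proof -
    have "inj_on mat_X (carrier (maxplus_trunc t))"
      by (auto simp: inj_on_def mat_X_def)
    moreover have "card (carrier (maxplus_trunc t)) = t + 2"
      by (subst maxplus_trunc_simps, subst card_insert_disjoint) (auto simp: card_image inj_on_def)
    ultimately show ?thesis by (simp only: card_image)
  qed
  moreover have finite_scalars: "finite (carrier (maxplus_trunc t))"
    by simp
  moreover have "card ?YZ = 2"
    by (simp add: mat_Y_def mat_Z_def to_trunc_def min_def)
  moreover have "?X \<inter> ?YZ = {}"
    by (auto simp: mat_X_def mat_Y_def mat_Z_def)
  moreover have "(?X \<union> ?YZ) \<inter> ?W = {}"
    by (auto simp: mat_X_def mat_Y_def mat_Z_def mat_W_def)
  moreover have "finite ?W"
    by (rule finite_subset[of _ "(\<lambda>(j, k). mat_W j k) ` ({1..t} \<times> {1..t})"]) auto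
  ultimately have "card (generators t) = t + 4 + card ?W"
    unfolding generators_def by (subst card_Un_disjoint; simp only: card_Un_disjoint finite_insert
        finite.emptyI finite_UnI finite_imageI finite_scalars)
  then have "2 * card (generators t) = 2 * (t + 4) + t * (t + 1)"
    using card_mat_W_generators[of t] by simp
  then show ?thesis by (simp add: power2_eq_square)
qed

section \<open>Generation\<close>

lemma generators_subset_carrier: "generators t \<subseteq> carrier (mat2_monoid (maxplus_trunc t))"
  by (auto simp: generators_def mat_X_def mat_Y_def mat_Z_def mat_W_def to_trunc_def min_def)

text \<open>
  The generated monoid is the intersection of all submonoids that contain the generators, so each
  of these has to be shown to contain every matrix.
\<close>

locale submonoid_with_generators =
  fixes t :: nat and H :: "nat extended mat2 set"
  assumes submonoid: "submonoid H (mat2_monoid (maxplus_trunc t))"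
    and generators: "generators t \<subseteq> H"
begin

abbreviation scalars :: "nat extended set" where
  "scalars \<equiv> carrier (maxplus_trunc t)"

abbreviation times :: "nat extended \<Rightarrow> nat extended \<Rightarrow> nat extended" (infixl "\<odot>" 70) where
  "a \<odot> b \<equiv> a \<otimes>\<^bsub>maxplus_trunc t\<^esub> b"

lemma mult_mem:
  assumes "A \<in> H" "B \<in> H"
  shows "mat2_mult (maxplus_trunc t) A B \<in> H"
  using submonoid.m_closed[OF submonoid assms] by simp

lemma X_mem: "i \<in> scalars \<Longrightarrow> mat_X i \<in> H"
  using generators by (auto simp: generators_def)

lemma Y_mem: "mat_Y t \<in> H"
  using generators by (auto simp: generators_def)

lemma Z_mem: "mat_Z \<in> H"
  using generators by (auto simp: generators_def)

lemma W_mem: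
  assumes "1 \<le> j" "j \<le> k" "k \<le> t"
  shows "mat_W j k \<in> H"
proof -
  have "j \<in> {1..t} \<and> k \<in> {1..t} \<and> j \<le> k"
    using assms by auto
  then have "mat_W j k \<in> generators t"
    unfolding generators_def by blast
  then show ?thesis using generators by blast
qed

lemma scalars_mult [simp]:
  assumes "a \<in> scalars"
  shows "min (a + Fin 0) (Fin t) = a" "min (Fin 0 + a) (Fin t) = a"
    "min (a + -\<infinity>) (Fin t) = -\<infinity>" "min (-\<infinity> + a) (Fin t) = -\<infinity>"
  using assms by auto

lemma swap_mem: "Mat2 (-\<infinity>) (Fin 0) (Fin 0) (-\<infinity>) \<in> H"
  using X_mem[of "-\<infinity>"] by (simp add: mat_X_def)

lemma mem_carrier: "Mat2 a b c d \<in> H \<Longrightarrow> {a, b, c, d} \<subseteq> scalars"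
  using submonoid.subset[OF submonoid] by (auto simp del: maxplus_trunc_simps)

lemma swap_rows:
  assumes "Mat2 a b c d \<in> H"
  shows "Mat2 c d a b \<in> H"
  using mult_mem[OF swap_mem assms] mem_carrier[OF assms] by (simp del: maxplus_trunc_simps(1))

lemma swap_columns:
  assumes "Mat2 a b c d \<in> H"
  shows "Mat2 b a d c \<in> H"
  using mult_mem[OF assms swap_mem] mem_carrier[OF assms] by (simp del: maxplus_trunc_simps(1))

lemma diagonal_mem:
  assumes "a \<in> scalars"
  shows "Mat2 a (-\<infinity>) (-\<infinity>) (Fin 0) \<in> H"
proof -
  have "Mat2 (Fin n) (-\<infinity>) (-\<infinity>) (Fin 0) \<in> H" if "n \<le> t" for n
    using that
  proof (induction n)
    case 0
    show ?case using submonoid.one_closed[OF submonoid] by simp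
  next
    case (Suc n)
    then show ?case
      using mult_mem[OF Suc.IH Y_mem] by (simp add: mat_Y_def to_trunc_def)
  qed
  then show ?thesis using assms Z_mem by (auto simp: mat_Z_def)
qed

lemma scale_row1:
  assumes "Mat2 a b c d \<in> H" "p \<in> scalars"
  shows "Mat2 (p \<odot> a) (p \<odot> b) c d \<in> H"
  using mult_mem[OF diagonal_mem[OF assms(2)] assms(1)] mem_carrier[OF assms(1)]
  by (simp del: maxplus_trunc_simps(1))

lemma scale_column1:
  assumes "Mat2 a b c d \<in> H" "p \<in> scalars"
  shows "Mat2 (a \<odot> p) b (c \<odot> p) d \<in> H"
  using mult_mem[OF assms(1) diagonal_mem[OF assms(2)]] mem_carrier[OF assms(1)]
  by (simp del: maxplus_trunc_simps(1))

lemma scale_row2: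
  assumes "Mat2 a b c d \<in> H" "p \<in> scalars"
  shows "Mat2 a b (p \<odot> c) (p \<odot> d) \<in> H"
  using swap_rows[OF scale_row1[OF swap_rows[OF assms(1)] assms(2)]] .

lemma scale_column2:
  assumes "Mat2 a b c d \<in> H" "p \<in> scalars"
  shows "Mat2 a (b \<odot> p) c (d \<odot> p) \<in> H"
  using swap_columns[OF scale_column1[OF swap_columns[OF assms(1)] assms(2)]] .

text \<open>
  The zeros of \<open>X\<^bsub>a\<^esub>\<close> lie in different rows and columns, so scaling the second row by \<open>c\<close> and
  the second column by \<open>b\<close> prescribes them independently and leaves \<open>a\<close> alone.
\<close>

lemma minus_infinity_corner_mem:
  assumes "a \<in> scalars" "b \<in> scalars" "c \<in> scalars"
  shows "Mat2 a b c (-\<infinity>) \<in> H"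
  using scale_row2[OF scale_column2[OF X_mem[OF assms(1), unfolded mat_X_def] assms(2)] assms(3)]
    assms by (simp del: maxplus_trunc_simps(1))

lemma with_minus_infinity_mem:
  assumes "{a, b, c, d} \<subseteq> scalars" "-\<infinity> \<in> {a, b, c, d}"
  shows "Mat2 a b c d \<in> H"
proof -
  consider "a = -\<infinity>" | "b = -\<infinity>" | "c = -\<infinity>" | "d = -\<infinity>"
    using assms(2) by auto
  then show ?thesis
  proof cases
    case 1
    then show ?thesis
      using swap_rows[OF swap_columns[OF minus_infinity_corner_mem[of d c b]]] assms(1) by blast
  next
    case 2
    then show ?thesis
      using swap_rows[OF minus_infinity_corner_mem[of c d a]] assms(1) by blast
  next
    case 3
    then show ?thesis
      using swap_columns[OF minus_infinity_corner_mem[of b a d]] assms(1) by blast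
  next
    case 4
    then show ?thesis
      using minus_infinity_corner_mem[of a b c] assms(1) by blast
  qed
qed

text \<open>
  A lower triangular matrix times an upper triangular one has as its bottom right entry a maximum
  with an arbitrary competitor \<open>k\<close>, while its other entries are single products.
\<close>

lemma three_zeros_mem:
  assumes "k \<le> t"
  shows "Mat2 (Fin 0) (Fin 0) (Fin 0) (Fin k) \<in> H"
proof -
  have "mat2_mult (maxplus_trunc t) (Mat2 (Fin 0) (-\<infinity>) (Fin 0) (Fin k))
      (Mat2 (Fin 0) (Fin 0) (-\<infinity>) (Fin 0)) = Mat2 (Fin 0) (Fin 0) (Fin 0) (Fin k)"
    using assms by simp
  then show ?thesis
    using mult_mem[OF with_minus_infinity_mem with_minus_infinity_mem,
        of "Fin 0" "-\<infinity>" "Fin 0" "Fin k" "Fin 0" "Fin 0" "-\<infinity>" "Fin 0"] assms by simp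
qed

lemma zero_diagonal_mem:
  assumes "j \<le> t" "k \<le> t"
  shows "Mat2 (Fin 0) (Fin j) (Fin k) (Fin 0) \<in> H"
proof -
  consider "j = 0" | "k = 0" | "1 \<le> j" "j \<le> k" | "1 \<le> k" "k \<le> j"
    by linarith
  then show ?thesis
  proof cases
    case 1
    then show ?thesis using swap_columns[OF three_zeros_mem[OF assms(2)]] by simp
  next
    case 2
    then show ?thesis using swap_rows[OF three_zeros_mem[OF assms(1)]] by simp
  next
    case 3
    then show ?thesis using W_mem[of j k] assms by (simp add: mat_W_def)
  next
    case 4
    then show ?thesis
      using swap_rows[OF swap_columns[of "Fin 0" "Fin k" "Fin j" "Fin 0"]] W_mem[of k j] assms
      by (simp add: mat_W_def)
  qed
qed

text \<open>
  Scaling up by a minimum undoes the subtraction of that minimum: the sums are entries of the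
  matrix aimed at, so they are at most \<open>t\<close> and truncation does not interfere.
\<close>

lemma finite_entries_mem:
  assumes "a \<le> t" "b \<le> t" "c \<le> t" "d \<le> t"
  shows "Mat2 (Fin a) (Fin b) (Fin c) (Fin d) \<in> H"
proof -
  let ?F = "\<lambda>a b c d. Mat2 (Fin a) (Fin b) (Fin c) (Fin d) \<in> H"
  have zero_column: "?F 0 j 0 k" if "j \<le> t" "k \<le> t" for j k
  proof -
    have "?F 0 (j - min j k) 0 (k - min j k)"
    proof (cases "j \<le> k")
      case True
      then show ?thesis using three_zeros_mem[of "k - j"] that by simp
    next
      case False
      then show ?thesis using swap_rows[OF three_zeros_mem[of "j - k"]] that by simp
    qed
    from scale_column2[OF this, of "Fin (min j k)"] show ?thesis
      using that by (simp add: min_def split: if_splits)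
  qed
  have zero_corner: "?F 0 j k l" if "j \<le> t" "k \<le> t" "l \<le> t" "k = 0 \<or> l = 0" for j k l
    using that zero_column zero_diagonal_mem by auto
  have zero_in_rows: "?F i j k l"
    if "i \<le> t" "j \<le> t" "k \<le> t" "l \<le> t" "i = 0 \<or> j = 0" "k = 0 \<or> l = 0" for i j k l
    using that zero_corner[of j k l] swap_columns[OF zero_corner[of i l k]] by auto
  have "?F (a - min a b) (b - min a b) (c - min c d) (d - min c d)"
    by (rule zero_in_rows) (use assms in auto)
  from scale_row2[OF scale_row1[OF this, of "Fin (min a b)"], of "Fin (min c d)"]
  show ?thesis
    using assms by (simp add: min_def split: if_splits)
qed

lemma carrier_subset: "carrier (mat2_monoid (maxplus_trunc t)) \<subseteq> H"
proof
  fix A assume A: "A \<in> carrier (mat2_monoid (maxplus_trunc t))"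
  obtain a b c d where [simp]: "A = Mat2 a b c d" by (cases A)
  show "A \<in> H"
  proof (cases "-\<infinity> \<in> {a, b, c, d}")
    case True
    then show ?thesis
      using with_minus_infinity_mem[of a b c d] A by (simp del: maxplus_trunc_simps(1))
  next
    case False
    then show ?thesis using A finite_entries_mem by auto
  qed
qed

end

theorem corollary2p2:
  fixes t :: nat
  shows "monoid (mat2_monoid (maxplus_trunc t))
    \<and> finite (carrier (mat2_monoid (maxplus_trunc t)))
    \<and> 2 * card (generators t) = t^2 + 3 * t + 8
    \<and> monoid_generated (mat2_monoid (maxplus_trunc t)) (generators t)
        = carrier (mat2_monoid (maxplus_trunc t))"
proof (intro conjI)
  let ?M = "mat2_monoid (maxplus_trunc t)"
  show M: "monoid ?M"
    by (rule semiring.monoid_mat2_monoid[OF semiring_maxplus_trunc])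
  show "finite (carrier ?M)"
    by (rule finite_mat2_monoid) simp
  show "2 * card (generators t) = t^2 + 3 * t + 8"
    by (rule card_generators)
  have "submonoid (carrier ?M) ?M"
    using M by (simp add: submonoid_def monoid.m_closed monoid.one_closed del: mat2_monoid_simps)
  then show "monoid_generated ?M (generators t) = carrier ?M"
    unfolding monoid_generated_def
    using generators_subset_carrier submonoid_with_generators.carrier_subset
    by (intro hull_unique) (auto simp: submonoid_with_generators_def)
qed

end
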